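(* Let $X$ be any DSD space of cardinality $<\aleph_\omega$. Then $X$ is maximally resolvable. In particular, all monotonically normal spaces of cardinality $<\aleph_\omega$ are maximally resolvable.
   Context: Spaces are nonempty topological spaces. A space is $\kappa$-resolvable if it contains $\kappa$ many pairwise disjoint dense subsets. $\Delta(X)=\min\{|G|: G\neq\emptyset\text{ open in }X\}$; $X$ is maximally resolvable if it is $\Delta(X)$-resolvable. A subset $D$ of a space is strongly discrete if the points of $D$ can be separated by pairwise disjoint neighbourhoods. A space is SD if every non-isolated point of it is an accumulation point of some strongly discrete set. A space is DSD if all of its dense subspaces are SD. For a topological space $X$ with topology $\tau(X)$, let $\mathcal{M}(X)=\{\langle x,U\rangle\in X\times\tau(X): x\in U\}$. The space $X$ is monotonically normal if it is $T_1$ and there is a function $H:\mathcal{M}(X)\to\tau(X)$ such that (1) $x\in H(x,U)\subseteq U$ for each $\langle x,U\rangle\in\mathcal{M}(X)$; (2) if $H(x,U)\cap H(y,V)\neq\emptyset$ then $x\in V$ or $y\in U$. *)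

theory Defs
  imports "HOL-Analysis.Analysis"
begin

unbundle cardinal_syntax

(* \<open>has_card_aleph n A\<close> says |A| = aleph_n. It is a predicate on sets because cardSuc changes
   the type of its argument, so that no function of n can return aleph_n itself in a fixed type.
   A set of cardinality aleph_(n+1) has a subset B of cardinality aleph_n, so it loses nothing to
   require that the type of the elements of B is that of the elements of A. *)
primrec has_card_aleph :: "nat \<Rightarrow> 'a set \<Rightarrow> bool" where
  "has_card_aleph 0 A \<longleftrightarrow> |A| =o natLeq"
| "has_card_aleph (Suc n) A \<longleftrightarrow> (\<exists>B :: 'a set. has_card_aleph n B \<and> |A| =o cardSuc |B| )"

(* aleph_omega is the supremum of the aleph_n, and the infinite cardinals below it are exactly
   the aleph_n with n finite. *)
definition card_less_aleph_omega :: "'a set \<Rightarrow> bool" where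
  "card_less_aleph_omega A \<longleftrightarrow> finite A \<or> (\<exists>n. has_card_aleph n A)"

definition dense_subset :: "'a topology \<Rightarrow> 'a set \<Rightarrow> bool" where
  "dense_subset X D \<longleftrightarrow> D \<subseteq> topspace X \<and> X closure_of D = topspace X"

(* Cardinals are represented by cardinal orders, as in the library. In a nonempty space dense
   sets are nonempty, so pairwise disjoint members of \<D> are automatically distinct as an
   indexed family. *)
definition resolvable :: "'k rel \<Rightarrow> 'a topology \<Rightarrow> bool" where
  "resolvable \<kappa> X \<longleftrightarrow>
     (\<exists>\<D>. |\<D>| =o \<kappa> \<and> pairwise disjnt \<D> \<and> (\<forall>D\<in>\<D>. dense_subset X D))"

(* The minimum of the cardinals |G|; it exists for nonempty X and is unique up to =o,
   see \<open>dispersion_character_attained\<close>. *)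
definition dispersion_character :: "'a topology \<Rightarrow> 'a rel" where
  "dispersion_character X =
     (SOME \<kappa>. (\<exists>G. openin X G \<and> G \<noteq> {} \<and> \<kappa> = |G| )
            \<and> (\<forall>H. openin X H \<and> H \<noteq> {} \<longrightarrow> \<kappa> \<le>o |H| ))"

definition maximally_resolvable :: "'a topology \<Rightarrow> bool" where
  "maximally_resolvable X \<longleftrightarrow> resolvable (dispersion_character X) X"

definition strongly_discrete :: "'a topology \<Rightarrow> 'a set \<Rightarrow> bool" where
  "strongly_discrete X D \<longleftrightarrow> D \<subseteq> topspace X \<and>
     (\<exists>U. (\<forall>x\<in>D. openin X (U x) \<and> x \<in> U x) \<and> disjoint_family_on U D)"

definition SD_space :: "'a topology \<Rightarrow> bool" where
  "SD_space X \<longleftrightarrow>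
     (\<forall>x\<in>topspace X. \<not> openin X {x} \<longrightarrow>
        (\<exists>D. strongly_discrete X D \<and> x \<in> X derived_set_of D))"

definition DSD_space :: "'a topology \<Rightarrow> bool" where
  "DSD_space X \<longleftrightarrow> (\<forall>Y. dense_subset X Y \<longrightarrow> SD_space (subtopology X Y))"

(* Only the values H x U with x \<in> U and U open matter. *)
definition monotonically_normal :: "'a topology \<Rightarrow> bool" where
  "monotonically_normal X \<longleftrightarrow> t1_space X \<and>
     (\<exists>H :: 'a \<Rightarrow> 'a set \<Rightarrow> 'a set.
        (\<forall>x U. openin X U \<and> x \<in> U \<longrightarrow>
           openin X (H x U) \<and> x \<in> H x U \<and> H x U \<subseteq> U) \<and>
        (\<forall>x U y V. openin X U \<and> x \<in> U \<and> openin X V \<and> y \<in> V \<and> H x U \<inter> H y V \<noteq> {} \<longrightarrow>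
           x \<in> V \<or> y \<in> U))"

lemma dispersion_character_attained:
  assumes "topspace X \<noteq> {}"
  shows "\<exists>G. openin X G \<and> G \<noteq> {} \<and> dispersion_character X = |G|"
    and "\<And>H. openin X H \<Longrightarrow> H \<noteq> {} \<Longrightarrow> dispersion_character X \<le>o |H|"
proof -
  let ?R = "card_of ` {G. openin X G \<and> G \<noteq> {}}"
  have "?R \<noteq> {}" using assms by (auto intro: openin_topspace)
  moreover have "\<forall>r\<in>?R. Card_order r" using card_of_Card_order by blast
  ultimately have "\<exists>r\<in>?R. \<forall>r'\<in>?R. r \<le>o r'" by (rule exists_minim_Card_order)
  then have "\<exists>\<kappa>. (\<exists>G. openin X G \<and> G \<noteq> {} \<and> \<kappa> = |G| )
            \<and> (\<forall>H. openin X H \<and> H \<noteq> {} \<longrightarrow> \<kappa> \<le>o |H| )"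
    by auto
  from someI_ex[OF this]
  show "\<exists>G. openin X G \<and> G \<noteq> {} \<and> dispersion_character X = |G|"
    and "\<And>H. openin X H \<Longrightarrow> H \<noteq> {} \<Longrightarrow> dispersion_character X \<le>o |H|"
    unfolding dispersion_character_def by blast+
qed

lemma has_card_aleph_unique:
  fixes A B :: "'a set"
  shows "has_card_aleph n A \<Longrightarrow> has_card_aleph n B \<Longrightarrow> |A| =o |B|"
proof (induction n arbitrary: A B)
  case 0
  then show ?case by (auto intro: ordIso_transitive ordIso_symmetric)
next
  case (Suc n)
  from Suc.prems obtain C :: "'a set" where "has_card_aleph n C" "|A| =o cardSuc |C|" by auto
  moreover from Suc.prems obtain D :: "'a set" where "has_card_aleph n D" "|B| =o cardSuc |D|" by auto
  moreover have "cardSuc |C| =o cardSuc |D|"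
    if "has_card_aleph n C" "has_card_aleph n D" for C D :: "'a set"
    using Suc.IH[OF that] by (simp add: cardSuc_invar_ordIso card_of_Card_order)
  ultimately show ?case by (meson ordIso_transitive ordIso_symmetric)
qed

lemma has_card_aleph_ordLeq:
  fixes A B :: "'a set"
  shows "has_card_aleph n A \<Longrightarrow> |B| \<le>o |A| \<Longrightarrow> finite B \<or> (\<exists>m\<le>n. has_card_aleph m B)"
proof (induction n arbitrary: A B)
  case 0
  show ?case
  proof (cases "finite B")
    case False
    then have "natLeq \<le>o |B|" using infinite_iff_natLeq_ordLeq by blast
    moreover have "|B| \<le>o natLeq" using 0 by (auto intro: ordLeq_ordIso_trans)
    ultimately show ?thesis by (auto simp: ordIso_iff_ordLeq)
  qed simp
next
  case (Suc n)
  then obtain C :: "'a set" where C: "has_card_aleph n C" "|A| =o cardSuc |C|" by auto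
  have B: "|B| \<le>o cardSuc |C|" using Suc.prems(2) C(2) by (rule ordLeq_ordIso_trans)
  show ?case
  proof (cases "|B| \<le>o |C|")
    case True
    then show ?thesis using Suc.IH[OF C(1)] by (meson le_SucI)
  next
    case False
    then have "|C| <o |B|" by (simp add: not_ordLeq_iff_ordLess card_of_Well_order)
    then have "cardSuc |C| \<le>o |B|" by (simp add: cardSuc_least card_of_Card_order)
    with B have "|B| =o cardSuc |C|" by (simp add: ordIso_iff_ordLeq)
    with C(1) have "has_card_aleph (Suc n) B" by auto
    then show ?thesis by blast
  qed
qed

end

theory Submission
  imports Defs
begin

text \<open>Fix an open set \<open>H\<close> all of whose nonempty open subsets have cardinality \<open>|H| = \<aleph>\<^sub>n\<close>, and call
  sets of cardinality below \<open>|H|\<close> small. A point is light if it is in the closure of small sets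
  disjoint from any given small set. If the light points are dense in \<open>H\<close>, transfinite recursion
  produces \<open>|H|\<close> disjoint dense subsets. Otherwise some open \<open>V \<subseteq> H\<close> has no light point. Small sets
  have dense complements, so DSD provides for each \<open>x \<in> V\<close> a strongly discrete set that meets every
  neighbourhood of \<open>x\<close> in \<open>|H|\<close> points, and iterating yields a tree of points in \<open>V\<close>.
  The tree is \<open>\<aleph>\<^sub>0\<close>-resolvable by its levels. A Kunen--Prikry style argument maps each of these
  strongly discrete sets to \<open>\<aleph>\<^sub>m\<close>, for every \<open>m \<le> n\<close>, such that the image of every neighbourhood of \<open>x\<close>
  has full size. Together with injections of the ordinals below \<open>\<aleph>\<^sub>m\<^sub>+\<^sub>1\<close> into \<open>\<aleph>\<^sub>m\<close>, this lifts
  \<open>\<aleph>\<^sub>m\<close>-resolvability of the tree to \<open>\<aleph>\<^sub>m\<^sub>+\<^sub>1\<close>.\<close>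

subsection \<open>Regular cardinals and decomposability\<close>

lemma Cinfinite_card_of: "infinite A \<Longrightarrow> Cinfinite |A|"
  by (simp add: cinfinite_def Field_card_of card_of_card_order_on)

text \<open>The base case is the regularity of \<open>natLeq\<close>, the step that of infinite
  successor cardinals. Regularity keeps unions of few small sets small.\<close>

lemma has_card_aleph_infinite_regular:
  fixes A :: "'a set"
  assumes "has_card_aleph n A"
  shows "infinite A \<and> regularCard |A|"
  using assms
proof (induction n arbitrary: A)
  case 0
  then have A: "|A| =o natLeq" by simp
  then have "infinite A"
    by (meson infinite_iff_natLeq_ordLeq ordIso_iff_ordLeq)
  moreover have "regularCard |A|"
    using regularCard_ordIso[OF ordIso_symmetric[OF A] natLeq_Cinfinite regularCard_natLeq] .
  ultimately show ?case by simp
next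
  case (Suc n)
  then obtain B :: "'a set" where B: "has_card_aleph n B" "|A| =o cardSuc |B|" by auto
  with Suc.IH have "Cinfinite |B|"
    by (simp add: Cinfinite_card_of)
  then have S: "Cinfinite (cardSuc |B| )" "regularCard (cardSuc |B| )"
    by (simp_all add: Cinfinite_cardSuc regularCard_cardSuc)
  have "Cinfinite |A|" using Cinfinite_cong[OF ordIso_symmetric[OF B(2)] S(1)] .
  moreover have "regularCard |A|" using regularCard_ordIso[OF ordIso_symmetric[OF B(2)] S] .
  ultimately show ?case by (simp add: cinfinite_def Field_card_of)
qed

lemma card_of_full_subset:
  assumes "S \<subseteq> A" "\<not> |S| <o |A|"
  shows "|S| =o |A|"
  using assms by (meson card_of_Well_order card_of_mono1 not_ordLess_iff_ordLeq ordIso_iff_ordLeq)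

lemma card_of_finite_ordLess_infinite:
  assumes "finite F" "infinite A"
  shows "|F| <o |A|"
  using assms by (meson card_of_ordLeq_finite card_of_Well_order not_ordLess_iff_ordLeq)

text \<open>The cardinal \<open>|A|\<close> is itself a well-order on \<open>A\<close>, so it
  doubles as an initial ordinal: \<open>underS |A| a\<close> is the segment below \<open>a\<close>,
  of size less than \<open>|A|\<close> for \<open>a\<close> in \<open>A\<close>.\<close>

lemma underS_card_of_Total:
  assumes "a \<in> A" "b \<in> A" "b \<notin> underS |A| a"
  shows "(a, b) \<in> |A|"
proof -
  have "Total |A|" "Refl |A|"
    using card_of_Well_order[of A] unfolding order_on_defs by auto
  then show ?thesis
    using assms unfolding total_on_def refl_on_def underS_def Field_card_of by fastforce
qed

lemma exists_greater_card_of: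
  assumes "infinite A" "a \<in> A"
  shows "\<exists>b\<in>A. a \<in> underS |A| b"
  using infinite_Card_order_limit[OF card_of_Card_order, of A a] assms
  by (auto simp: Field_card_of underS_def)

lemma card_of_trans: "(a, b) \<in> |A| \<Longrightarrow> (b, c) \<in> |A| \<Longrightarrow> (a, c) \<in> |A|"
  and card_of_antisym: "(a, b) \<in> |A| \<Longrightarrow> (b, a) \<in> |A| \<Longrightarrow> a = b"
  using card_of_Well_order[of A] unfolding order_on_defs trans_def antisym_def by blast+

lemma full_subset_unbounded:
  assumes "infinite A" "S \<subseteq> A" "|S| =o |A|" "a \<in> A"
  shows "\<exists>s\<in>S. a \<in> underS |A| s"
proof (rule ccontr)
  assume no: "\<not> ?thesis"
  obtain b where b: "b \<in> A" "a \<in> underS |A| b" using exists_greater_card_of assms by metis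
  have "s \<in> underS |A| b" if "s \<in> S" for s
  proof -
    have "(s, a) \<in> |A|" using underS_card_of_Total[of s A a] no that assms by blast
    with b(2) show ?thesis using card_of_trans card_of_antisym unfolding underS_def
      by (metis (mono_tags, lifting) mem_Collect_eq)
  qed
  then have "|S| \<le>o |underS |A| b|" by (simp add: card_of_mono1 subsetI)
  also have "|underS |A| b| <o |A|"
    using card_of_underS[OF card_of_Card_order] b by (simp add: Field_card_of)
  finally show False using assms(3) not_ordLess_ordIso by blast
qed

lemma small_subset_bounded:
  assumes "infinite C" "regularCard |C|" "K \<subseteq> C" "|K| <o |C|"
  shows "\<exists>c\<in>C. K \<subseteq> underS |C| c"
proof -
  have "\<not> cofinal K |C|"
    using assms unfolding regularCard_def Field_card_of using not_ordLess_ordIso by blast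
  then obtain a where a: "a \<in> C" "\<And>k. k \<in> K \<Longrightarrow> a = k \<or> (a, k) \<notin> |C|"
    unfolding cofinal_def Field_card_of by blast
  obtain b where b: "b \<in> C" "a \<in> underS |C| b" using exists_greater_card_of assms(1) a(1) by metis
  have "k \<in> underS |C| b" if "k \<in> K" for k
  proof -
    have "(k, a) \<in> |C|" using underS_card_of_Total[of k C a] a that assms(3)
      by (auto simp: underS_def)
    with b(2) show ?thesis using card_of_trans card_of_antisym unfolding underS_def
      by (metis (mono_tags, lifting) mem_Collect_eq)
  qed
  with b(1) show ?thesis by blast
qed

lemma unbounded_subset_full:
  assumes "regularCard |C|" "K \<subseteq> C" "\<And>c. c \<in> C \<Longrightarrow> \<exists>k\<in>K. c \<in> underS |C| k"
  shows "|K| =o |C|"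
proof -
  have "cofinal K |C|"
    using assms(3) by (auto simp: cofinal_def Field_card_of underS_def)
  with assms(1,2) show ?thesis by (simp add: regularCard_def Field_card_of)
qed

text \<open>This is the data of an Ulam matrix: \<open>g a\<close> codes each ordinal below
  \<open>a\<close> by an element of \<open>C\<close>. It serves twice, to decompose filters and to
  lift colourings.\<close>

lemma initial_segment_injections:
  assumes "|A| =o cardSuc |C|"
  shows "\<exists>g. \<forall>a\<in>A. inj_on (g a) (underS |A| a) \<and> g a ` underS |A| a \<subseteq> C"
proof -
  have "\<exists>f. inj_on f (underS |A| a) \<and> f ` underS |A| a \<subseteq> C" if "a \<in> A" for a
  proof -
    have "|underS |A| a| <o |A|"
      using card_of_underS[OF card_of_Card_order] that by (simp add: Field_card_of)
    also have "|A| =o cardSuc |C|" by fact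
    finally have "|underS |A| a| \<le>o |C|"
      by (simp add: cardSuc_ordLeq_ordLess card_of_Card_order)
    then show ?thesis by (simp add: card_of_ordLeq)
  qed
  then show ?thesis by metis
qed

lemma pigeonhole_regular:
  assumes "infinite A" "regularCard |A|" "|C| <o |A|" "\<And>a. a \<in> A \<Longrightarrow> f a \<in> C"
  shows "\<exists>c\<in>C. \<not> |{a \<in> A. f a = c}| <o |A|"
proof (rule ccontr)
  assume "\<not> ?thesis"
  then have "|\<Union>c\<in>C. {a \<in> A. f a = c}| <o |A|"
    using assms by (intro regularCard_UNION_bound) (auto simp: Cinfinite_card_of)
  moreover have "(\<Union>c\<in>C. {a \<in> A. f a = c}) = A" using assms(4) by auto
  ultimately show False using ordLess_irreflexive by metis
qed

text \<open>The candidates \<open>f x\<close> read off the value at \<open>x\<close> of the injection \<open>g a\<close>. If all of them fail, they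
  are bounded on members of \<open>\<F>\<close>, for many \<open>x = e i\<close> by the same \<open>d\<close>; then each \<open>a\<close> lies in few of the
  witnessing sets \<open>S (e i)\<close>, and a bound \<open>h a\<close> for the indices \<open>i\<close> of these is unbounded on every
  member of \<open>\<F>\<close>.\<close>
lemma successor_decomposable:
  assumes A: "|A| =o cardSuc |C|" and C: "infinite C" "regularCard |C|"
    and dir: "\<And>S T. S \<in> \<F> \<Longrightarrow> T \<in> \<F> \<Longrightarrow> \<exists>R\<in>\<F>. R \<subseteq> S \<inter> T"
    and large: "\<And>S. S \<in> \<F> \<Longrightarrow> S \<subseteq> A \<and> |S| =o |A|"
  shows "\<exists>h. h ` A \<subseteq> C \<and> (\<forall>S\<in>\<F>. |h ` S| =o |C| )"
proof -
  have CA: "|C| <o |A|"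
    using A cardSuc_greater[OF card_of_Card_order] ordLess_ordIso_trans ordIso_symmetric by blast
  have CC: "Cinfinite |C|" using C by (simp add: Cinfinite_card_of)
  have infA: "infinite A"
    using CA C(1) card_of_ordLeq_finite ordLess_imp_ordLeq by blast
  have regA: "regularCard |A|"
    using regularCard_ordIso[OF ordIso_symmetric[OF A]] CC
    by (simp add: Cinfinite_cardSuc regularCard_cardSuc)
  obtain g where g: "\<And>a. a \<in> A \<Longrightarrow> inj_on (g a) (underS |A| a)"
      "\<And>a. a \<in> A \<Longrightarrow> g a ` underS |A| a \<subseteq> C"
    using initial_segment_injections[OF A] by metis
  obtain c0 where c0: "c0 \<in> C" using C(1) by fastforce
  \<comment> \<open>The default \<open>c0\<close> keeps all values in \<open>C\<close>. When all
    candidates fail, \<open>f x a\<close> is read off only where \<open>x\<close> precedes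
    \<open>a\<close>.\<close>
  define f where "f x a = (if x \<in> underS |A| a then g a x else c0)" for x a
  have fC: "f x ` A \<subseteq> C" for x using g c0 by (auto simp: f_def)
  show ?thesis
  proof (cases "\<exists>x\<in>A. \<forall>S\<in>\<F>. |f x ` S| =o |C|")
    case True
    with fC show ?thesis by blast
  next
    case False
    have "\<exists>S c. S \<in> \<F> \<and> c \<in> C \<and> f x ` S \<subseteq> underS |C| c" if x: "x \<in> A" for x
    proof -
      obtain S where S: "S \<in> \<F>" "\<not> |f x ` S| =o |C|" using False x by blast
      have fS: "f x ` S \<subseteq> C" using fC[of x] large[OF S(1)] by (meson image_mono order_trans)
      then have "|f x ` S| <o |C|" using S(2) card_of_full_subset by metis
      then show ?thesis
        using small_subset_bounded[OF C fS] S(1) by metis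
    qed
    then obtain S c where Sc: "\<And>x. x \<in> A \<Longrightarrow> S x \<in> \<F>" "\<And>x. x \<in> A \<Longrightarrow> c x \<in> C"
        "\<And>x. x \<in> A \<Longrightarrow> f x ` S x \<subseteq> underS |C| (c x)"
      by metis
    obtain d where d: "d \<in> C" "\<not> |{x \<in> A. c x = d}| <o |A|"
      using pigeonhole_regular[OF infA regA CA, of c] Sc(2) by blast
    then have "|C| \<le>o |{x \<in> A. c x = d}|"
      using CA by (meson card_of_Well_order not_ordLess_iff_ordLeq ordLeq_transitive ordLess_imp_ordLeq)
    then obtain e where e: "inj_on e C" "e ` C \<subseteq> {x \<in> A. c x = d}"
      using card_of_ordLeq by metis
    define I where "I a = {i \<in> C. a \<in> S (e i) \<and> e i \<in> underS |A| a}" for a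
    \<comment> \<open>The injection \<open>g a\<close> sends the points \<open>e i\<close> with
      \<open>i\<close> in \<open>I a\<close> below \<open>d\<close>, so \<open>I a\<close> has fewer
      than \<open>|C|\<close> elements and regularity bounds it.\<close>
    have "\<exists>b\<in>C. I a \<subseteq> underS |C| b" if "a \<in> A" for a
    proof -
      have "inj_on (\<lambda>i. g a (e i)) (I a)"
        using e(1) g(1)[OF that] unfolding inj_on_def I_def by blast
      moreover have "(\<lambda>i. g a (e i)) ` I a \<subseteq> underS |C| d"
      proof
        fix y assume "y \<in> (\<lambda>i. g a (e i)) ` I a"
        then obtain i where i: "i \<in> C" "a \<in> S (e i)" "e i \<in> underS |A| a" "y = g a (e i)"
          by (auto simp: I_def)
        then have "y = f (e i) a" by (simp add: f_def)
        moreover have "e i \<in> A" "c (e i) = d" using e(2) i(1) by auto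
        ultimately show "y \<in> underS |C| d" using Sc(3)[of "e i"] i(2) by auto
      qed
      ultimately have "|I a| \<le>o |underS |C| d|" using card_of_ordLeq by blast
      also have "|underS |C| d| <o |C|"
        using card_of_underS[OF card_of_Card_order] d by (simp add: Field_card_of)
      finally show ?thesis by (intro small_subset_bounded[OF C]) (auto simp: I_def)
    qed
    then obtain h where h: "\<And>a. a \<in> A \<Longrightarrow> h a \<in> C" "\<And>a. a \<in> A \<Longrightarrow> I a \<subseteq> underS |C| (h a)"
      by metis
    have "|h ` T| =o |C|" if T: "T \<in> \<F>" for T
    proof (rule unbounded_subset_full[OF C(2)])
      show "h ` T \<subseteq> C" using h(1) large[OF T] by auto
    next
      fix i assume i: "i \<in> C"
      then have ei: "e i \<in> A" using e(2) by auto
      \<comment> \<open>Directedness lets one \<open>a\<close> lie in both \<open>T\<close> and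
        \<open>S (e i)\<close>, and sets of full size are unbounded, so \<open>a\<close> can be
        taken above \<open>e i\<close>. Then \<open>i\<close> is below \<open>h a\<close>.\<close>
      obtain R where R: "R \<in> \<F>" "R \<subseteq> T \<inter> S (e i)" using dir[OF T Sc(1)[OF ei]] by blast
      obtain a where a: "a \<in> R" "e i \<in> underS |A| a"
        using full_subset_unbounded[OF infA _ _ ei, of R] large[OF R(1)] by blast
      then have "i \<in> I a" using i R by (auto simp: I_def)
      moreover have "a \<in> A" using a large[OF R(1)] by auto
      ultimately show "\<exists>k\<in>h ` T. i \<in> underS |C| k" using h(2) a R by blast
    qed
    with h(1) show ?thesis by blast
  qed
qed

subsection \<open>Colourings with dense colour classes\<close>

lemma maximal_disjoint_subfamily:
  "\<exists>\<M>\<subseteq>\<F>. pairwise disjnt \<M> \<and> (\<forall>A\<in>\<F>. A \<noteq> {} \<longrightarrow> (\<exists>B\<in>\<M>. \<not> disjnt A B))"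
proof -
  let ?Z = "{\<M>. \<M> \<subseteq> \<F> \<and> pairwise disjnt \<M>}"
  have "\<exists>M\<in>?Z. \<forall>N\<in>?Z. M \<subseteq> N \<longrightarrow> N = M"
  proof (rule subset_Zorn')
    fix \<C> assume "subset.chain ?Z \<C>"
    then have sub: "\<C> \<subseteq> ?Z" and ch: "\<And>M N. M \<in> \<C> \<Longrightarrow> N \<in> \<C> \<Longrightarrow> M \<subseteq> N \<or> N \<subseteq> M"
      by (auto simp: subset_chain_def)
    have "pairwise disjnt (\<Union>\<C>)"
      unfolding pairwise_def
    proof (intro ballI impI)
      fix A B assume "A \<in> \<Union>\<C>" "B \<in> \<Union>\<C>" and ne: "A \<noteq> B"
      then obtain M where "M \<in> \<C>" "A \<in> M" "B \<in> M" using ch by blast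
      with sub ne show "disjnt A B" by (auto dest: pairwiseD)
    qed
    with sub show "\<Union>\<C> \<in> ?Z" by blast
  qed
  then obtain M where M: "M \<subseteq> \<F>" "pairwise disjnt M"
      and max: "\<And>N. N \<subseteq> \<F> \<Longrightarrow> pairwise disjnt N \<Longrightarrow> M \<subseteq> N \<Longrightarrow> N = M" by auto
  have "\<exists>B\<in>M. \<not> disjnt A B" if A: "A \<in> \<F>" "A \<noteq> {}" for A
  proof (rule ccontr)
    assume no: "\<not> ?thesis"
    then have "pairwise disjnt (insert A M)"
      using M(2) by (auto simp: pairwise_insert disjnt_sym)
    then have "insert A M = M" using max[of "insert A M"] A M(1) by blast
    with no A(2) show False by (auto simp: disjnt_def)
  qed
  with M show ?thesis by blast
qed

text \<open>Colour classes are disjoint by construction, so only density has to be arranged.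
  \<open>P\<close> may be any set, so that trees qualify, and colours have a type of their own, so
  that numbers and pairs qualify.\<close>

definition colourable :: "'a topology \<Rightarrow> 'a set \<Rightarrow> 'b set \<Rightarrow> bool" where
  "colourable X P B \<longleftrightarrow>
     (\<exists>c. \<forall>b\<in>B. \<forall>U. openin X U \<and> U \<inter> P \<noteq> {} \<longrightarrow> (\<exists>y\<in>U \<inter> P. c y = b))"

lemma colourable_mono:
  assumes "colourable X P B" "|C| \<le>o |B|"
  shows "colourable X P C"
proof -
  obtain e where e: "inj_on e C" "e ` C \<subseteq> B" using assms(2) card_of_ordLeq by metis
  obtain c where c: "\<And>b U. b \<in> B \<Longrightarrow> openin X U \<Longrightarrow> U \<inter> P \<noteq> {} \<Longrightarrow> \<exists>y\<in>U \<inter> P. c y = b"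
    using assms(1) unfolding colourable_def by metis
  have "\<exists>y\<in>U \<inter> P. inv_into C e (c y) = b" if "b \<in> C" "openin X U" "U \<inter> P \<noteq> {}" for b U
    using c[of "e b" U] that e by (metis image_subset_iff inv_into_f_f)
  then show ?thesis unfolding colourable_def by (intro exI[of _ "\<lambda>y. inv_into C e (c y)"]) blast
qed

text \<open>A maximal disjoint family of colourable sets has dense union: every nonempty open set
  contains a colourable set, which meets a member. Disjointness lets the colourings of the members
  be glued.\<close>

lemma resolvable_if_locally_colourable:
  assumes ne: "topspace X \<noteq> {}"
    and loc: "\<And>G. openin X G \<Longrightarrow> G \<noteq> {} \<Longrightarrow> \<exists>P\<subseteq>G. P \<noteq> {} \<and> colourable X P B"
  shows "resolvable |B| X"
proof -
  let ?F = "{P. P \<subseteq> topspace X \<and> P \<noteq> {} \<and> colourable X P B}"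
  obtain \<M> where M: "\<M> \<subseteq> ?F" "pairwise disjnt \<M>"
      and max: "\<And>A. A \<in> ?F \<Longrightarrow> \<exists>P\<in>\<M>. \<not> disjnt A P"
    using maximal_disjoint_subfamily[of ?F] by auto
  have "\<forall>P\<in>\<M>. \<exists>c. \<forall>b\<in>B. \<forall>U. openin X U \<and> U \<inter> P \<noteq> {} \<longrightarrow> (\<exists>y\<in>U \<inter> P. c y = b)"
    using M(1) unfolding colourable_def by blast
  then obtain c where c: "\<And>P b U. P \<in> \<M> \<Longrightarrow> b \<in> B \<Longrightarrow> openin X U \<Longrightarrow> U \<inter> P \<noteq> {} \<Longrightarrow>
      \<exists>y\<in>U \<inter> P. c P y = b"
    by metis
  define D where "D b = {y. \<exists>P\<in>\<M>. y \<in> P \<and> c P y = b}" for b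
  have meets: "\<exists>y. y \<in> D b \<and> y \<in> U" if U: "openin X U" "U \<noteq> {}" and b: "b \<in> B" for U b
  proof -
    obtain P where P: "P \<subseteq> U" "P \<noteq> {}" "colourable X P B" using loc U by blast
    then have "P \<in> ?F" using openin_subset[OF U(1)] by blast
    then obtain Q where Q: "Q \<in> \<M>" "\<not> disjnt P Q" using max by blast
    then have "U \<inter> Q \<noteq> {}" using P(1) by (auto simp: disjnt_def)
    then show ?thesis using c[OF Q(1) b U(1)] Q(1) by (auto simp: D_def)
  qed
  have dense: "dense_subset X (D b)" if "b \<in> B" for b
  proof -
    have "D b \<subseteq> topspace X" using M(1) by (auto simp: D_def)
    moreover have "X closure_of D b = topspace X"
      unfolding dense_intersects_open using meets[OF _ _ that] by blast
    ultimately show ?thesis by (simp add: dense_subset_def)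
  qed
  have disj: "b = b'" if y: "y \<in> D b" "y \<in> D b'" for y b b'
  proof -
    obtain P P' where P: "P \<in> \<M>" "y \<in> P" "c P y = b" "P' \<in> \<M>" "y \<in> P'" "c P' y = b'"
      using y by (auto simp: D_def)
    then have "P = P'" using M(2) by (metis pairwiseD disjnt_iff)
    with P show ?thesis by simp
  qed
  have "inj_on D B"
  proof (rule inj_onI)
    fix b b' assume b: "b \<in> B" and eq: "D b = D b'"
    obtain y where "y \<in> D b" using meets[OF openin_topspace ne b] by blast
    then show "b = b'" using disj[of y b b'] eq by blast
  qed
  then have "|D ` B| =o |B|"
    by (intro ordIso_symmetric[OF card_of_ordIsoI[OF inj_on_imp_bij_betw]])
  moreover have "pairwise disjnt (D ` B)"
    unfolding pairwise_image by (rule pairwiseI) (use disj in \<open>auto simp: disjnt_iff\<close>)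
  ultimately show ?thesis
    unfolding resolvable_def using dense by (intro exI[of _ "D ` B"]) simp
qed

text \<open>Neighbourhoods of a point meet the next level, hence all later ones. Colouring level
  \<open>k\<close> by the first component of \<open>prod_decode k\<close> makes every colour recur
  on arbitrarily high levels.\<close>

lemma colourable_nat_levels:
  assumes "\<And>j k :: nat. j \<noteq> k \<Longrightarrow> disjnt (L j) (L k)"
    and "\<And>U x k. openin X U \<Longrightarrow> x \<in> U \<Longrightarrow> x \<in> L k \<Longrightarrow> \<exists>y\<in>U. y \<in> L (Suc k)"
  shows "colourable X (\<Union>k. L k) (UNIV :: nat set)"
proof -
  define c where "c y = fst (prod_decode (THE k. y \<in> L k))" for y
  have c: "c y = fst (prod_decode k)" if "y \<in> L k" for y k
  proof -
    have "(THE k. y \<in> L k) = k"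
      using that assms(1) unfolding disjnt_def by (intro the_equality) blast+
    then show ?thesis by (simp add: c_def)
  qed
  have step: "\<exists>y\<in>U. y \<in> L (k + j)" if "openin X U" "x \<in> U" "x \<in> L k" for U x k j
  proof (induction j)
    case 0
    with that show ?case by auto
  next
    case (Suc j)
    with assms(2) that(1) show ?case by fastforce
  qed
  have "\<exists>y\<in>U \<inter> (\<Union>k. L k). c y = b" if U: "openin X U" "U \<inter> (\<Union>k. L k) \<noteq> {}" for U and b :: nat
  proof -
    obtain x k where x: "x \<in> U" "x \<in> L k" using U(2) by auto
    \<comment> \<open>Level \<open>prod_encode (b, k)\<close> has colour \<open>b\<close> and does
      not come before level \<open>k\<close>.\<close>
    have "k + (prod_encode (b, k) - k) = prod_encode (b, k)"
      using le_prod_encode_2[of k b] by simp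
    then obtain y where "y \<in> U" "y \<in> L (prod_encode (b, k))"
      using step[OF U(1) x, of "prod_encode (b, k) - k"] by auto
    moreover have "c y = b" using c[OF \<open>y \<in> L _\<close>] by simp
    ultimately show ?thesis by blast
  qed
  then show ?thesis unfolding colourable_def by blast
qed

text \<open>The colour classes are unions of pairwise disjoint small sets, chosen by transfinite recursion
  over the pairs of a point of \<open>L\<close> and a colour.\<close>
lemma colourable_if_light_dense:
  assumes inf: "infinite H" and reg: "regularCard |H|"
    and L: "L \<subseteq> H" "\<And>U. openin X U \<Longrightarrow> U \<inter> H \<noteq> {} \<Longrightarrow> U \<inter> L \<noteq> {}"
    and light: "\<And>x Z. x \<in> L \<Longrightarrow> Z \<subseteq> H \<Longrightarrow> |Z| <o |H| \<Longrightarrow>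
      \<exists>S\<subseteq>H - Z. |S| <o |H| \<and> (\<forall>U. openin X U \<and> x \<in> U \<longrightarrow> U \<inter> S \<noteq> {})"
  shows "colourable X H H"
proof (cases "L = {}")
  case True
  then have "\<And>U. openin X U \<Longrightarrow> U \<inter> H = {}" using L(2) by blast
  then show ?thesis unfolding colourable_def by blast
next
  case False
  have "|L \<times> H| \<le>o |H|"
  proof (rule card_of_Times_ordLeq_infinite_Field)
    show "|L| \<le>o |H|" using L(1) by (rule card_of_mono1)
  qed (use inf in \<open>auto simp: Field_card_of card_of_Card_order ordLeq_refl card_of_Well_order card_of_card_order_on\<close>)
  then obtain \<phi> where \<phi>: "\<phi> ` H = L \<times> H"
    using card_of_ordLeq2[of "L \<times> H" H] False inf by auto
  let ?R = "|H| - Id"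
  have wf: "wf ?R" using card_of_Well_order[of H] by (auto simp: well_order_on_def)
  have R: "{j. (j, i) \<in> ?R} = underS |H| i" for i by (auto simp: underS_def)
  \<comment> \<open>The recursion runs over the whole type, so the condition is void at indices
    outside \<open>H\<close>.\<close>
  define Q where "Q S i T \<longleftrightarrow> (i \<in> H \<longrightarrow> T \<subseteq> H - (\<Union>j\<in>{j. (j, i) \<in> ?R}. S j) \<and> |T| <o |H| \<and>
      (\<forall>U. openin X U \<and> fst (\<phi> i) \<in> U \<longrightarrow> U \<inter> T \<noteq> {}))" for S i T
  have "\<exists>S. \<forall>i. Q S i (S i)"
  proof (rule dependent_wf_choice[OF wf])
    fix S S' :: "'a \<Rightarrow> 'a set" and i T
    assume "\<And>z. (z, i) \<in> ?R \<Longrightarrow> S z = S' z"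
    then have "(\<Union>j\<in>{j. (j, i) \<in> ?R}. S j) = (\<Union>j\<in>{j. (j, i) \<in> ?R}. S' j)" by blast
    then show "Q S i T = Q S' i T" unfolding Q_def by simp
  next
    fix i and S :: "'a \<Rightarrow> 'a set"
    assume IH: "\<And>j. (j, i) \<in> ?R \<Longrightarrow> Q S j (S j)"
    show "\<exists>T. Q S i T"
    proof (cases "i \<in> H")
      case True
      let ?Z = "\<Union>j\<in>{j. (j, i) \<in> ?R}. S j"
      have jH: "j \<in> H" if "(j, i) \<in> ?R" for j
        using that FieldI1[of j i "|H|"] by (simp add: Field_card_of)
      have "?Z \<subseteq> H" using IH jH unfolding Q_def by blast
      \<comment> \<open>Fewer than \<open>|H|\<close> small sets have been chosen before
        \<open>i\<close>. By regularity their union is small, so lightness yields a set avoiding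
        it.\<close>
      moreover have "|?Z| <o |H|"
      proof (rule regularCard_UNION_bound[OF Cinfinite_card_of[OF inf] reg])
        show "|{j. (j, i) \<in> ?R}| <o |H|" unfolding R
          using card_of_underS[OF card_of_Card_order] True by (simp add: Field_card_of)
      qed (use IH jH in \<open>auto simp: Q_def\<close>)
      moreover have "fst (\<phi> i) \<in> L" using \<phi> True by (metis imageI mem_Times_iff)
      ultimately show ?thesis unfolding Q_def using light[of "fst (\<phi> i)" ?Z] by blast
    qed (simp add: Q_def)
  qed
  then obtain S where S: "\<And>i. Q S i (S i)" by blast
  have SH: "S i \<subseteq> H" if "i \<in> H" for i using S[of i] that unfolding Q_def by blast
  have disj: "i = j" if "i \<in> H" "j \<in> H" "y \<in> S i" "y \<in> S j" for i j y
  proof (rule ccontr)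
    assume "i \<noteq> j"
    then have "(i, j) \<in> ?R \<or> (j, i) \<in> ?R"
      using underS_card_of_Total[of i H j] that by (auto simp: underS_def)
    then show False
      using S[of i] S[of j] that unfolding Q_def by blast
  qed
  define c where "c y = snd (\<phi> (THE i. i \<in> H \<and> y \<in> S i))" for y
  have c: "c y = snd (\<phi> i)" if "i \<in> H" "y \<in> S i" for y i
  proof -
    have "(THE i. i \<in> H \<and> y \<in> S i) = i"
      using that disj by (intro the_equality) auto
    then show ?thesis by (simp add: c_def)
  qed
  have "\<exists>y\<in>U \<inter> H. c y = b" if b: "b \<in> H" and U: "openin X U" "U \<inter> H \<noteq> {}" for U b
  proof -
    obtain x where x: "x \<in> U" "x \<in> L" using L(2)[OF U] by blast
    then obtain i where i: "i \<in> H" "\<phi> i = (x, b)" using \<phi> b by (metis SigmaI imageE)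
    then have "U \<inter> S i \<noteq> {}" using S[of i] x(1) U(1) unfolding Q_def by simp
    then obtain y where "y \<in> U" "y \<in> S i" by blast
    then show ?thesis using c[OF i(1)] i SH by auto
  qed
  then show ?thesis unfolding colourable_def by blast
qed

subsection \<open>Trees of strongly discrete sets\<close>

text \<open>A tree of points grows from \<open>r\<close>: the successors of a node \<open>x\<close> are the points of the strongly
  discrete set \<open>D x\<close> lying in the open set reserved for the subtree of \<open>x\<close>.\<close>
locale discrete_tree =
  fixes X :: "'a topology" and V H :: "'a set" and r :: 'a
    and D :: "'a \<Rightarrow> 'a set" and U :: "'a \<Rightarrow> 'a \<Rightarrow> 'a set"
  assumes V: "openin X V" and r: "r \<in> V" and infinite_H: "infinite H"
    and D_sub: "x \<in> V \<Longrightarrow> D x \<subseteq> H"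
    and U: "x \<in> V \<Longrightarrow> d \<in> D x \<Longrightarrow> openin X (U x d) \<and> d \<in> U x d \<and> x \<notin> U x d"
    and U_disj: "x \<in> V \<Longrightarrow> disjoint_family_on (U x) (D x)"
    and D_large: "x \<in> V \<Longrightarrow> openin X G \<Longrightarrow> x \<in> G \<Longrightarrow> |D x \<inter> G| =o |H|"
begin

text \<open>The reserved set depends on the branch leading to the node, hence it is carried along
  with the point.\<close>

primrec level :: "nat \<Rightarrow> ('a \<times> 'a set) set" where
  "level 0 = {(r, V)}"
| "level (Suc k) = {(d, W \<inter> U x d) | x W d. (x, W) \<in> level k \<and> d \<in> D x \<inter> W}"

definition points :: "nat \<Rightarrow> 'a set" where
  "points k = fst ` level k"

lemma level_open: "(x, W) \<in> level k \<Longrightarrow> openin X W \<and> x \<in> W \<and> W \<subseteq> V"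
proof (induction k arbitrary: x W)
  case 0
  then show ?case using V r by simp
next
  case (Suc k)
  then obtain z W' where z: "(z, W') \<in> level k" "x \<in> D z" "x \<in> W'" "W = W' \<inter> U z x" by auto
  with Suc.IH[OF z(1)] U[of z x] show ?case by (auto intro: openin_Int)
qed

lemma level_disjoint:
  "(x, W) \<in> level k \<Longrightarrow> (x', W') \<in> level k \<Longrightarrow> y \<in> W \<Longrightarrow> y \<in> W' \<Longrightarrow> x = x' \<and> W = W'"
proof (induction k arbitrary: x W x' W')
  case 0
  then show ?case by simp
next
  case (Suc k)
  obtain z Z where z: "(z, Z) \<in> level k" "x \<in> D z" "W = Z \<inter> U z x"
    using Suc.prems(1) by auto
  obtain z' Z' where z': "(z', Z') \<in> level k" "x' \<in> D z'" "W' = Z' \<inter> U z' x'"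
    using Suc.prems(2) by auto
  have eq: "z = z'" "Z = Z'" using Suc.IH[OF z(1) z'(1)] Suc.prems(3,4) z(3) z'(3) by auto
  have "z \<in> V" using level_open[OF z(1)] by blast
  then have "x = x'"
    using U_disj[of z] z z' eq Suc.prems(3,4) unfolding disjoint_family_on_def by blast
  with eq z z' show ?case by simp
qed

text \<open>Because \<open>x \<notin> U x d\<close>, the reserved sets of proper descendants of
  \<open>x\<close> omit \<open>x\<close>. This is what separates the levels.\<close>

lemma level_ancestor:
  "(y, W') \<in> level (k + j) \<Longrightarrow> \<exists>x W. (x, W) \<in> level k \<and> W' \<subseteq> W \<and> (j > 0 \<longrightarrow> x \<notin> W')"
proof (induction j arbitrary: y W')
  case 0
  then show ?case by auto
next
  case (Suc j)
  then obtain z Z where z: "(z, Z) \<in> level (k + j)" "y \<in> D z" "W' = Z \<inter> U z y" by auto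
  then have zV: "z \<notin> U z y" using level_open[OF z(1)] U[of z y] by blast
  show ?case
  proof (cases "j = 0")
    case True
    with z zV show ?thesis by auto
  next
    case False
    with Suc.IH[OF z(1)] z(3) show ?thesis by blast
  qed
qed

text \<open>A point \<open>y\<close> on levels \<open>j\<close> and \<open>j + i\<close> has an
  ancestor on level \<open>j\<close> whose reserved set contains \<open>y\<close>. By
  \<open>level_disjoint\<close> this ancestor is \<open>y\<close> itself, although it is omitted
  from the reserved set of its descendant.\<close>

lemma points_disjoint:
  assumes "j \<noteq> k"
  shows "disjnt (points j) (points k)"
proof -
  have *: "y \<notin> points (j + i)" if i: "i > 0" and y: "y \<in> points j" for i j y
  proof
    assume "y \<in> points (j + i)"
    then obtain W' where W': "(y, W') \<in> level (j + i)" by (auto simp: points_def)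
    then obtain x W where x: "(x, W) \<in> level j" "W' \<subseteq> W" "x \<notin> W'"
      using level_ancestor i by blast
    obtain Y where Y: "(y, Y) \<in> level j" using y by (auto simp: points_def)
    have "x = y"
      using level_disjoint[OF x(1) Y, of y] level_open[OF Y] level_open[OF W'] x(2) by blast
    with x(3) level_open[OF W'] show False by blast
  qed
  show ?thesis
  proof (cases "j < k")
    case True
    with *[of "k - j" _ j] show ?thesis by (auto simp: disjnt_iff)
  next
    case False
    with assms *[of "j - k" _ k] show ?thesis by (auto simp: disjnt_iff)
  qed
qed

lemma points_step:
  assumes "openin X G" "x \<in> G" "x \<in> points k"
  shows "\<exists>y\<in>G. y \<in> points (Suc k)"
proof -
  obtain W where W: "(x, W) \<in> level k" using assms(3) by (auto simp: points_def)
  note WV = level_open[OF W]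
  have "|D x \<inter> (G \<inter> W)| =o |H|"
    by (rule D_large) (use WV assms in auto)
  then have "D x \<inter> (G \<inter> W) \<noteq> {}"
    using infinite_H card_of_ordIso_finite by fastforce
  then obtain y where y: "y \<in> D x" "y \<in> G" "y \<in> W" by blast
  then have "(y, W \<inter> U x y) \<in> level (Suc k)" using W by auto
  then have "y \<in> points (Suc k)" unfolding points_def by (metis fst_conv imageI)
  with y show ?thesis by blast
qed

section \<open>Colourings of the tree\<close>

definition Tree :: "'a set" where
  "Tree = (\<Union>k. points k)"

lemma Tree_props: "r \<in> Tree" "Tree \<subseteq> V"
proof -
  have "r \<in> points 0" by (simp add: points_def)
  then show "r \<in> Tree" by (auto simp: Tree_def)
  show "Tree \<subseteq> V" using level_open by (fastforce simp: Tree_def points_def)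
qed

lemma colourable_Tree_nat: "colourable X Tree (UNIV :: nat set)"
  unfolding Tree_def by (rule colourable_nat_levels) (auto intro: points_disjoint points_step)

text \<open>In terms of filters: for every \<open>x\<close> in \<open>V\<close>, the trace on
  \<open>D x\<close> of the neighbourhood filter of \<open>x\<close> is decomposed into
  \<open>|B|\<close> pieces, and each of its members meets \<open>|B|\<close> of them.\<close>

definition spread :: "('a \<Rightarrow> 'a \<Rightarrow> 'a) \<Rightarrow> 'a set \<Rightarrow> bool" where
  "spread f B \<longleftrightarrow> (\<forall>x\<in>V. f x ` D x \<subseteq> B \<and>
     (\<forall>G. openin X G \<and> x \<in> G \<longrightarrow> |f x ` (D x \<inter> G)| =o |B| ))"

text \<open>For each \<open>x\<close>, the images of the traces of neighbourhoods form a filter base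
  on \<open>B\<close> of sets of full size. Composing \<open>f x\<close> with the map given by
  \<open>successor_decomposable\<close> passes from \<open>B\<close> to \<open>C\<close>.\<close>

lemma spread_predecessor:
  assumes f: "spread f B" and B: "|B| =o cardSuc |C|" and C: "infinite C" "regularCard |C|"
  shows "\<exists>f'. spread f' C"
proof -
  have "\<exists>h. h ` D x \<subseteq> C \<and> (\<forall>G. openin X G \<and> x \<in> G \<longrightarrow> |h ` (D x \<inter> G)| =o |C| )"
    if x: "x \<in> V" for x
  proof -
    define F where "F = (\<lambda>G. f x ` (D x \<inter> G)) ` {G. openin X G \<and> x \<in> G}"
    have "\<exists>h. h ` B \<subseteq> C \<and> (\<forall>S\<in>F. |h ` S| =o |C| )"
    proof (rule successor_decomposable[OF B C])
      fix S T assume "S \<in> F" "T \<in> F"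
      then obtain G G' where G: "openin X G" "x \<in> G" "S = f x ` (D x \<inter> G)"
        "openin X G'" "x \<in> G'" "T = f x ` (D x \<inter> G')" by (auto simp: F_def)
      then have "f x ` (D x \<inter> (G \<inter> G')) \<in> F"
        unfolding F_def by (intro imageI) (auto intro: openin_Int)
      then show "\<exists>R\<in>F. R \<subseteq> S \<inter> T" by (rule bexI[rotated]) (use G in blast)
    next
      fix S assume "S \<in> F"
      then obtain G where G: "openin X G" "x \<in> G" "S = f x ` (D x \<inter> G)" by (auto simp: F_def)
      have fx: "f x ` D x \<subseteq> B" "|f x ` (D x \<inter> G)| =o |B|" using f x G unfolding spread_def by auto
      then show "S \<subseteq> B \<and> |S| =o |B|" unfolding G(3) by auto
    qed
    then obtain h where h: "h ` B \<subseteq> C" "\<forall>S\<in>F. |h ` S| =o |C|" by (elim exE conjE)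
    have "f x ` D x \<subseteq> B" using f x unfolding spread_def by simp
    then have "(h \<circ> f x) ` D x \<subseteq> C" using h(1) by fastforce
    moreover have "|(h \<circ> f x) ` (D x \<inter> G)| =o |C|" if "openin X G" "x \<in> G" for G
    proof -
      have "f x ` (D x \<inter> G) \<in> F" unfolding F_def using that by (intro imageI) simp
      with h(2) show ?thesis unfolding image_comp[symmetric] by (rule bspec)
    qed
    ultimately show ?thesis by blast
  qed
  then obtain f' where "\<And>x. x \<in> V \<Longrightarrow> f' x ` D x \<subseteq> C \<and>
      (\<forall>G. openin X G \<and> x \<in> G \<longrightarrow> |f' x ` (D x \<inter> G)| =o |C| )"
    by metis
  then show ?thesis unfolding spread_def by blast
qed

text \<open>To give a descendant of \<open>x\<close> the colour \<open>b\<close>, pass to a child \<open>d\<close> of \<open>x\<close> with \<open>b < f x d\<close>; then \<open>b\<close>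
  is determined by \<open>f x d\<close> and an element of \<open>C\<close>. The descendants of \<open>d\<close> carry all pairs of a level
  and an element of \<open>C\<close>, and the level tells them which ancestor to use.\<close>
lemma colourable_Tree_successor:
  assumes f: "spread f B" and B: "|B| =o cardSuc |C|" and inf: "infinite B" "infinite C"
    and col: "colourable X Tree C"
  shows "colourable X Tree B"
proof -
  \<comment> \<open>Adding a level number to each colour does not increase their number, as
    \<open>C\<close> is infinite.\<close>
  have "|(UNIV :: nat set) \<times> C| \<le>o |C|"
    using card_of_Times_infinite[OF inf(2), of "UNIV :: nat set"] inf(2)
    by (simp add: infinite_iff_card_of_nat ordIso_imp_ordLeq)
  then have "colourable X Tree ((UNIV :: nat set) \<times> C)" by (rule colourable_mono[OF col])
  then obtain c where c: "\<And>k e G. e \<in> C \<Longrightarrow> openin X G \<Longrightarrow> G \<inter> Tree \<noteq> {} \<Longrightarrow>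
      \<exists>y\<in>G \<inter> Tree. c y = (k :: nat, e)"
    unfolding colourable_def by (metis UNIV_I mem_Sigma_iff)
  obtain g where g: "\<And>a. a \<in> B \<Longrightarrow> inj_on (g a) (underS |B| a)"
      "\<And>a. a \<in> B \<Longrightarrow> g a ` underS |B| a \<subseteq> C"
    using initial_segment_injections[OF B] by metis
  \<comment> \<open>Ancestry is expressed by membership of \<open>y\<close> in open sets, so a point
    found by density inside these sets can be decoded at once.\<close>
  define hit where "hit y i e b \<longleftrightarrow> (\<exists>x W d. (x, W) \<in> level i \<and> d \<in> D x \<and> y \<in> W \<and> y \<in> U x d \<and>
      b \<in> underS |B| (f x d) \<and> g (f x d) b = e)" for y i e b
  \<comment> \<open>Disjointness on level \<open>i\<close> determines \<open>x\<close>, disjointness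
    of the sets \<open>U x d\<close> determines \<open>d\<close>, and injectivity of
    \<open>g (f x d)\<close> recovers \<open>b\<close> from \<open>e\<close>.\<close>
  have hit_unique: "b = b'" if h: "hit y i e b" "hit y i e b'" for y i e b b'
  proof -
    obtain x W d where 1: "(x, W) \<in> level i" "d \<in> D x" "y \<in> W" "y \<in> U x d"
      "b \<in> underS |B| (f x d)" "g (f x d) b = e"
      using h(1) unfolding hit_def by blast
    obtain x' W' d' where 2: "(x', W') \<in> level i" "d' \<in> D x'" "y \<in> W'" "y \<in> U x' d'"
      "b' \<in> underS |B| (f x' d')" "g (f x' d') b' = e"
      using h(2) unfolding hit_def by blast
    have eq: "x = x'" using level_disjoint[OF 1(1) 2(1)] 1 2 by blast
    have xV: "x \<in> V" using level_open[OF 1(1)] by blast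
    then have "d = d'"
      using U_disj[OF xV] 1 2 eq unfolding disjoint_family_on_def by blast
    moreover have "f x d \<in> B" using f xV 1(2) unfolding spread_def by blast
    ultimately show ?thesis using g(1)[of "f x d"] 1 2 eq by (metis inj_onD)
  qed
  define c' where "c' y = (SOME b. hit y (fst (c y)) (snd (c y)) b)" for y
  have c': "c' y = b" if h: "hit y k e b" "c y = (k, e)" for y k e b
  proof -
    have "hit y k e (c' y)" unfolding c'_def h(2) fst_conv snd_conv using h(1) by (rule someI)
    then show ?thesis using hit_unique h(1) by blast
  qed
  have "\<exists>y\<in>G \<inter> Tree. c' y = b" if b: "b \<in> B" and G: "openin X G" "G \<inter> Tree \<noteq> {}" for b G
  proof -
    obtain x k W where x: "x \<in> G" "(x, W) \<in> level k"
      using G(2) by (auto simp: Tree_def points_def)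
    note W = level_open[OF x(2)]
    have xV: "x \<in> V" using W by blast
    have "openin X (G \<inter> W)" "x \<in> G \<inter> W" using G W x by auto
    then have "|f x ` (D x \<inter> (G \<inter> W))| =o |B|" "f x ` (D x \<inter> (G \<inter> W)) \<subseteq> B"
      using f xV unfolding spread_def by blast+
    then obtain d where d: "d \<in> D x" "d \<in> G" "d \<in> W" "b \<in> underS |B| (f x d)"
      using full_subset_unbounded[OF inf(1) _ _ b] by blast
    have "(d, W \<inter> U x d) \<in> level (Suc k)" using x(2) d by auto
    then have "d \<in> points (Suc k)" unfolding points_def by (metis fst_conv imageI)
    then have dT: "d \<in> Tree" unfolding Tree_def by blast
    have o: "openin X (G \<inter> W \<inter> U x d)" using G(1) W U[OF xV d(1)] by auto
    have ne: "G \<inter> W \<inter> U x d \<inter> Tree \<noteq> {}" using d dT U[OF xV d(1)] by blast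
    have "f x d \<in> B" using f xV d(1) unfolding spread_def by blast
    then have "g (f x d) b \<in> C" using g(2) d(4) by blast
    from c[OF this o ne, of k] obtain y where
      y: "y \<in> G" "y \<in> W" "y \<in> U x d" "y \<in> Tree" "c y = (k, g (f x d) b)" by blast
    have "hit y k (g (f x d) b) b" unfolding hit_def using x(2) d y by blast
    with c' y show ?thesis by blast
  qed
  then show ?thesis unfolding colourable_def by blast
qed

text \<open>The induction descends with \<open>spread_predecessor\<close> to the countable case,
  where the levels give the colouring, and climbs back with
  \<open>colourable_Tree_successor\<close>.\<close>

lemma colourable_Tree_aleph:
  "has_card_aleph n B \<Longrightarrow> spread f B \<Longrightarrow> colourable X Tree B"
proof (induction n arbitrary: B f)
  case 0
  then have "|B| =o natLeq" by simp
  then have "|B| \<le>o |UNIV :: nat set|"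
    by (rule ordIso_ordLeq_trans[OF _ ordIso_imp_ordLeq[OF ordIso_symmetric[OF card_of_nat]]])
  then show ?case by (rule colourable_mono[OF colourable_Tree_nat])
next
  case (Suc n)
  then obtain C :: "'a set" where C: "has_card_aleph n C" "|B| =o cardSuc |C|" by auto
  note reg = has_card_aleph_infinite_regular[OF C(1)]
  obtain f' where "spread f' C"
    using spread_predecessor[OF Suc.prems(2) C(2) conjunct1[OF reg] conjunct2[OF reg]] by (rule exE)
  then have "colourable X Tree C" by (rule Suc.IH[OF C(1)])
  moreover have "infinite B" using has_card_aleph_infinite_regular[OF Suc.prems(1)] by simp
  ultimately show ?case
    using colourable_Tree_successor[OF Suc.prems(2) C(2)] reg by simp
qed

lemma spread_identity: "spread (\<lambda>x d. d) H"
  using D_sub D_large unfolding spread_def by simp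

end

subsection \<open>Maximal resolvability\<close>

text \<open>Deleting the small set \<open>Z\<close> but keeping \<open>x\<close> leaves a dense
  subspace, where DSD gives a strongly discrete set accumulating at \<open>x\<close>. Apart from
  \<open>x\<close> it avoids \<open>Z\<close>, so if its part in \<open>H\<close> had a small trace
  on a neighbourhood of \<open>x\<close>, then \<open>heavy\<close> would separate that trace from
  \<open>x\<close>.\<close>

lemma heavy_point_discrete_set:
  assumes dsd: "DSD_space X" and H: "openin X H" "infinite H"
    and min: "\<And>G. openin X G \<Longrightarrow> G \<noteq> {} \<Longrightarrow> G \<subseteq> H \<Longrightarrow> |H| \<le>o |G|"
    and Z: "Z \<subseteq> H" "|Z| <o |H|"
    and x: "x \<in> H"
    and heavy: "\<And>S. S \<subseteq> H - Z \<Longrightarrow> |S| <o |H| \<Longrightarrow> \<exists>G. openin X G \<and> x \<in> G \<and> G \<inter> S = {}"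
  shows "\<exists>D U. D \<subseteq> H \<and> (\<forall>d\<in>D. openin X (U d) \<and> d \<in> U d \<and> x \<notin> U d) \<and>
    disjoint_family_on U D \<and> (\<forall>G. openin X G \<and> x \<in> G \<longrightarrow> |D \<inter> G| =o |H| )"
proof -
  define Y where "Y = insert x (topspace X - Z)"
  have xX: "x \<in> topspace X" using H(1) x openin_subset by blast
  have not_small: "\<not> G \<subseteq> insert x Z" if G: "openin X G" "G \<noteq> {}" "G \<subseteq> H" for G
  proof
    assume "G \<subseteq> insert x Z"
    then have "|G| \<le>o |insert x Z|" by (rule card_of_mono1)
    also have "|insert x Z| <o |H|"
      using card_of_Un_ordLess_infinite[OF H(2) card_of_finite_ordLess_infinite[of "{x}" H] Z(2)] H(2)
      by simp
    finally have "|G| <o |H|" .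
    with min[OF G] show False by (simp add: not_ordLess_ordLeq)
  qed
  have dense: "G \<inter> Y \<noteq> {}" if G: "openin X G" "G \<noteq> {}" for G
  proof
    assume no: "G \<inter> Y = {}"
    then have "G \<subseteq> Z" using openin_subset[OF G(1)] by (auto simp: Y_def)
    then show False using not_small[OF G] Z(1) by blast
  qed
  have "dense_subset X Y"
    unfolding dense_subset_def dense_intersects_open using dense xX by (auto simp: Y_def Int_commute)
  then have sd: "SD_space (subtopology X Y)" using dsd by (simp add: DSD_space_def)
  have topY: "topspace (subtopology X Y) = Y" using xX by (auto simp: Y_def)
  have "\<not> openin (subtopology X Y) {x}"
  proof
    assume "openin (subtopology X Y) {x}"
    then obtain G where G: "openin X G" "{x} = G \<inter> Y" by (auto simp: openin_subtopology)
    have "openin X (G \<inter> H)" "G \<inter> H \<noteq> {}" "G \<inter> H \<subseteq> H" using G H(1) x by auto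
    then have "\<not> G \<inter> H \<subseteq> insert x Z" by (rule not_small)
    moreover have "G \<inter> H \<subseteq> insert x Z"
      using G(2) openin_subset[OF G(1)] by (auto simp: Y_def)
    ultimately show False by blast
  qed
  then obtain E where E: "strongly_discrete (subtopology X Y) E"
      "x \<in> subtopology X Y derived_set_of E"
    using sd topY unfolding SD_space_def by (auto simp: Y_def)
  obtain U' where EY: "E \<subseteq> Y"
    and U': "\<And>d. d \<in> E \<Longrightarrow> openin (subtopology X Y) (U' d)" "\<And>d. d \<in> E \<Longrightarrow> d \<in> U' d"
    and U'd: "disjoint_family_on U' E"
    using E(1) unfolding strongly_discrete_def topY by blast
  from U'(1) have "\<forall>d\<in>E. \<exists>G. openin X G \<and> U' d = G \<inter> Y" by (simp add: openin_subtopology)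
  then obtain U where U: "\<And>d. d \<in> E \<Longrightarrow> openin X (U d)" "\<And>d. d \<in> E \<Longrightarrow> U' d = U d \<inter> Y"
    by metis
  have acc: "\<exists>d\<in>E. d \<noteq> x \<and> d \<in> G" if G: "openin X G" "x \<in> G" for G
  proof -
    have "openin (subtopology X Y) (G \<inter> Y)" using G(1) by (auto simp: openin_subtopology)
    moreover have "x \<in> G \<inter> Y" using G(2) by (simp add: Y_def)
    ultimately show ?thesis using E(2) unfolding in_derived_set_of by blast
  qed
  define D where "D = (E \<inter> H) - {x}"
  have DE: "D \<subseteq> E" by (auto simp: D_def)
  have DZ: "D \<subseteq> H - Z" using EY by (auto simp: D_def Y_def)
  \<comment> \<open>Open sets with disjoint traces on the dense set \<open>Y\<close> are
    disjoint.\<close>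
  have Udis: "disjoint_family_on U D"
    unfolding disjoint_family_on_def
  proof (intro ballI impI)
    fix d e assume de: "d \<in> D" "e \<in> D" "d \<noteq> e"
    then have "U' d \<inter> U' e = {}" using U'd DE unfolding disjoint_family_on_def by blast
    then have "U d \<inter> U e \<inter> Y = {}" using U(2) de DE by blast
    moreover have "openin X (U d \<inter> U e)" using U(1) de DE by blast
    ultimately show "U d \<inter> U e = {}" using dense by blast
  qed
  have large: "|D \<inter> G| =o |H|" if G: "openin X G" "x \<in> G" for G
  proof (rule card_of_full_subset)
    show "D \<inter> G \<subseteq> H" using DZ by blast
    show "\<not> |D \<inter> G| <o |H|"
    proof
      assume "|D \<inter> G| <o |H|"
      then obtain O' where O': "openin X O'" "x \<in> O'" "O' \<inter> (D \<inter> G) = {}"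
        using heavy[of "D \<inter> G"] DZ by blast
      then have "openin X (O' \<inter> G \<inter> H)" "x \<in> O' \<inter> G \<inter> H" using G H(1) x by auto
      then obtain d where "d \<in> E" "d \<noteq> x" "d \<in> O' \<inter> G \<inter> H" using acc by blast
      with O'(3) show False by (auto simp: D_def)
    qed
  qed
  \<comment> \<open>Otherwise \<open>U d\<close>, as a neighbourhood of \<open>x\<close>, would
    contain \<open>|H|\<close> points of \<open>D\<close>, while disjointness leaves only
    \<open>d\<close>.\<close>
  have xU: "x \<notin> U d" if d: "d \<in> D" for d
  proof
    assume "x \<in> U d"
    with large U(1) d DE have "|D \<inter> U d| =o |H|" by blast
    moreover have "D \<inter> U d \<subseteq> {d}"
    proof
      fix e assume e: "e \<in> D \<inter> U d"
      then have "e \<in> U e" using U'(2) U(2) DE by blast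
      with e d Udis show "e \<in> {d}" unfolding disjoint_family_on_def by blast
    qed
    ultimately show False using H(2) by (metis card_of_ordIso_finite finite.emptyI finite_insert finite_subset)
  qed
  have dU: "openin X (U d) \<and> d \<in> U d" if "d \<in> D" for d
    using that U U'(2) DE by blast
  show ?thesis
    using DZ dU xU Udis large by (intro exI[of _ D] exI[of _ U]) auto
qed

lemma infinite_minimal_open_colourable:
  assumes dsd: "DSD_space X" and H: "openin X H" "H \<noteq> {}" and aleph: "has_card_aleph n H"
    and min: "\<And>G. openin X G \<Longrightarrow> G \<noteq> {} \<Longrightarrow> G \<subseteq> H \<Longrightarrow> |H| \<le>o |G|"
  shows "\<exists>P\<subseteq>H. P \<noteq> {} \<and> colourable X P H"
proof -
  have inf: "infinite H" and reg: "regularCard |H|"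
    using has_card_aleph_infinite_regular[OF aleph] by auto
  define L where "L = {x \<in> H. \<forall>Z\<subseteq>H. |Z| <o |H| \<longrightarrow>
      (\<exists>S\<subseteq>H - Z. |S| <o |H| \<and> (\<forall>U. openin X U \<and> x \<in> U \<longrightarrow> U \<inter> S \<noteq> {}))}"
  show ?thesis
  proof (cases "\<forall>V. openin X V \<and> V \<subseteq> H \<and> V \<noteq> {} \<longrightarrow> V \<inter> L \<noteq> {}")
    case True
    have "colourable X H H"
    proof (rule colourable_if_light_dense[OF inf reg, of L])
      show "L \<subseteq> H" by (auto simp: L_def)
      fix U assume "openin X U" "U \<inter> H \<noteq> {}"
      then have "openin X (U \<inter> H)" "U \<inter> H \<subseteq> H" "U \<inter> H \<noteq> {}" using H by auto
      with True have "U \<inter> H \<inter> L \<noteq> {}" by blast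
      then show "U \<inter> L \<noteq> {}" by blast
    qed (simp add: L_def)
    with H(2) show ?thesis by blast
  next
    case False
    then obtain V where V: "openin X V" "V \<subseteq> H" "V \<noteq> {}" "V \<inter> L = {}" by blast
    note VH = V(2)
    have "\<exists>D U. D \<subseteq> H \<and> (\<forall>d\<in>D. openin X (U d) \<and> d \<in> U d \<and> x \<notin> U d) \<and>
        disjoint_family_on U D \<and> (\<forall>G. openin X G \<and> x \<in> G \<longrightarrow> |D \<inter> G| =o |H| )"
      if x: "x \<in> V" for x
    proof -
      have xH: "x \<in> H" and "x \<notin> L" using x V by auto
      \<comment> \<open>This \<open>Z\<close> depends on \<open>x\<close>, and so does the dense
        subspace in which the strongly discrete set for \<open>x\<close> is found.\<close>
      then obtain Z where Z: "Z \<subseteq> H" "|Z| <o |H|"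
        "\<not> (\<exists>S\<subseteq>H - Z. |S| <o |H| \<and> (\<forall>U. openin X U \<and> x \<in> U \<longrightarrow> U \<inter> S \<noteq> {}))"
        unfolding L_def by blast
      show ?thesis
        by (rule heavy_point_discrete_set[OF dsd H(1) inf min Z(1,2) xH]) (use Z(3) in blast)+
    qed
    then obtain D U where DU: "\<And>x. x \<in> V \<Longrightarrow> D x \<subseteq> H \<and>
        (\<forall>d\<in>D x. openin X (U x d) \<and> d \<in> U x d \<and> x \<notin> U x d) \<and>
        disjoint_family_on (U x) (D x) \<and> (\<forall>G. openin X G \<and> x \<in> G \<longrightarrow> |D x \<inter> G| =o |H| )"
      by metis
    obtain r where r: "r \<in> V" using V(3) by blast
    interpret discrete_tree X V H r D U
      by unfold_locales (use V r inf DU in auto)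
    have "colourable X Tree H" by (rule colourable_Tree_aleph[OF aleph spread_identity])
    moreover have "Tree \<subseteq> H" "Tree \<noteq> {}" using Tree_props VH by auto
    ultimately show ?thesis by blast
  qed
qed

text \<open>By minimality an open set meeting the finite set \<open>H\<close> contains it, so the
  identity is a suitable colouring.\<close>

lemma finite_minimal_open_colourable:
  assumes H: "openin X H" "finite H"
    and min: "\<And>G. openin X G \<Longrightarrow> G \<noteq> {} \<Longrightarrow> G \<subseteq> H \<Longrightarrow> |H| \<le>o |G|"
  shows "colourable X H H"
proof -
  have "b \<in> U" if b: "b \<in> H" and U: "openin X U" "U \<inter> H \<noteq> {}" for b U
  proof -
    have "|H| \<le>o |U \<inter> H|" using min[of "U \<inter> H"] H(1) U by auto
    then have "card H \<le> card (U \<inter> H)" using H(2) by (metis card_of_ordLeq card_inj_on_le finite_Int)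
    then have "U \<inter> H = H" using H(2) by (simp add: card_seteq)
    with b show ?thesis by blast
  qed
  then show ?thesis unfolding colourable_def by (intro exI[of _ "\<lambda>y. y"]) blast
qed

lemma minimal_open_subset:
  assumes "openin X G" "G \<noteq> {}"
  shows "\<exists>H. openin X H \<and> H \<noteq> {} \<and> H \<subseteq> G \<and>
    (\<forall>K. openin X K \<and> K \<noteq> {} \<and> K \<subseteq> H \<longrightarrow> |H| \<le>o |K| )"
proof -
  let ?R = "card_of ` {H. openin X H \<and> H \<noteq> {} \<and> H \<subseteq> G}"
  have "?R \<noteq> {}" using assms by auto
  moreover have "\<forall>r\<in>?R. Card_order r" using card_of_Card_order by blast
  ultimately have "\<exists>r\<in>?R. \<forall>r'\<in>?R. r \<le>o r'" by (rule exists_minim_Card_order)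
  then obtain H where "openin X H" "H \<noteq> {}" "H \<subseteq> G"
      "\<And>K. openin X K \<Longrightarrow> K \<noteq> {} \<Longrightarrow> K \<subseteq> G \<Longrightarrow> |H| \<le>o |K|"
    by auto
  then show ?thesis by (metis subset_trans)
qed

lemma DSD_maximally_resolvable:
  fixes X :: "'a topology"
  assumes ne: "topspace X \<noteq> {}" and small: "card_less_aleph_omega (topspace X)"
    and dsd: "DSD_space X"
  shows "maximally_resolvable X"
proof -
  obtain K where K: "openin X K" "dispersion_character X = |K|"
    using dispersion_character_attained(1)[OF ne] by blast
  have "resolvable |K| X"
  proof (rule resolvable_if_locally_colourable[OF ne])
    fix G assume "openin X G" "G \<noteq> {}"
    then obtain H where H: "openin X H" "H \<noteq> {}" "H \<subseteq> G"
        and min: "\<And>K. openin X K \<Longrightarrow> K \<noteq> {} \<Longrightarrow> K \<subseteq> H \<Longrightarrow> |H| \<le>o |K|"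
      using minimal_open_subset by metis
    have HX: "H \<subseteq> topspace X" using openin_subset H(1) .
    have "\<exists>P\<subseteq>H. P \<noteq> {} \<and> colourable X P H"
    proof (cases "finite H")
      case True
      with finite_minimal_open_colourable[OF H(1) True min] H(2) show ?thesis by blast
    next
      case False
      then have "infinite (topspace X)" using HX finite_subset by blast
      then obtain n where "has_card_aleph n (topspace X)"
        using small by (auto simp: card_less_aleph_omega_def)
      then obtain m where "has_card_aleph m H"
        using has_card_aleph_ordLeq[OF _ card_of_mono1[OF HX]] False by blast
      from infinite_minimal_open_colourable[OF dsd H(1,2) this min] show ?thesis .
    qed
    then obtain P where P: "P \<subseteq> H" "P \<noteq> {}" "colourable X P H" by blast
    \<comment> \<open>The size of \<open>H\<close> may exceed the dispersion character; surplus
      colours are dropped.\<close>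
    have "|K| \<le>o |H|" using dispersion_character_attained(2)[OF ne H(1,2)] K(2) by simp
    then have "colourable X P K" by (rule colourable_mono[OF P(3)])
    with P H(3) show "\<exists>P\<subseteq>G. P \<noteq> {} \<and> colourable X P K" by blast
  qed
  then show ?thesis by (simp add: maximally_resolvable_def K(2))
qed

section \<open>Monotonically normal spaces\<close>

lemma monotonically_normal_subtopology:
  assumes "monotonically_normal X"
  shows "monotonically_normal (subtopology X Y)"
proof -
  obtain H where t1: "t1_space X"
    and H: "\<And>x U. openin X U \<Longrightarrow> x \<in> U \<Longrightarrow> openin X (H x U) \<and> x \<in> H x U \<and> H x U \<subseteq> U"
    and sep: "\<And>x U y V. openin X U \<Longrightarrow> x \<in> U \<Longrightarrow> openin X V \<Longrightarrow> y \<in> V \<Longrightarrow>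
      H x U \<inter> H y V \<noteq> {} \<Longrightarrow> x \<in> V \<or> y \<in> U"
    using assms unfolding monotonically_normal_def by metis
  \<comment> \<open>For \<open>U\<close> open in the subspace, \<open>E U\<close> is its largest
    open extension to \<open>X\<close>. This canonical choice lets the operator of the subspace be
    the trace of \<open>H x (E U)\<close>.\<close>
  define E where "E U = \<Union>{G. openin X G \<and> G \<inter> Y \<subseteq> U}" for U
  have E: "openin X (E U)" "U \<subseteq> Y" "E U \<inter> Y = U" if U: "openin (subtopology X Y) U" for U
  proof -
    show "openin X (E U)" unfolding E_def by (rule openin_Union) simp
    show "U \<subseteq> Y" using openin_subset[OF U] by simp
    obtain G where "openin X G" "U = G \<inter> Y" using U by (auto simp: openin_subtopology)
    then show "E U \<inter> Y = U" by (auto simp: E_def)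
  qed
  have 1: "openin (subtopology X Y) (H x (E U) \<inter> Y) \<and> x \<in> H x (E U) \<inter> Y \<and> H x (E U) \<inter> Y \<subseteq> U"
    if U: "openin (subtopology X Y) U" "x \<in> U" for x U
  proof -
    have "x \<in> E U" "x \<in> Y" using E[OF U(1)] U(2) by auto
    with H[OF E(1)[OF U(1)], of x] E(3)[OF U(1)] show ?thesis
      by (auto simp: openin_subtopology)
  qed
  have 2: "x \<in> V \<or> y \<in> U"
    if U: "openin (subtopology X Y) U" "x \<in> U" and V: "openin (subtopology X Y) V" "y \<in> V"
      and meet: "H x (E U) \<inter> Y \<inter> (H y (E V) \<inter> Y) \<noteq> {}" for x U y V
  proof -
    have x: "x \<in> E U" "x \<in> Y" using E[OF U(1)] U(2) by auto
    have y: "y \<in> E V" "y \<in> Y" using E[OF V(1)] V(2) by auto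
    have "x \<in> E V \<or> y \<in> E U"
      using sep[OF E(1)[OF U(1)] x(1) E(1)[OF V(1)] y(1)] meet by blast
    with x y E(3)[OF U(1)] E(3)[OF V(1)] show ?thesis by blast
  qed
  show ?thesis
    unfolding monotonically_normal_def
  proof (intro conjI exI[of _ "\<lambda>x U. H x (E U) \<inter> Y"])
    show "t1_space (subtopology X Y)" using t1 by (rule t1_space_subtopology)
    show "\<forall>x U. openin (subtopology X Y) U \<and> x \<in> U \<longrightarrow>
        openin (subtopology X Y) (H x (E U) \<inter> Y) \<and> x \<in> H x (E U) \<inter> Y \<and> H x (E U) \<inter> Y \<subseteq> U"
      by (intro allI impI 1) simp_all
    show "\<forall>x U y V. openin (subtopology X Y) U \<and> x \<in> U \<and> openin (subtopology X Y) V \<and> y \<in> V \<and>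
        H x (E U) \<inter> Y \<inter> (H y (E V) \<inter> Y) \<noteq> {} \<longrightarrow> x \<in> V \<or> y \<in> U"
      by (intro allI impI, elim conjE) (rule 2)
  qed
qed

text \<open>The set consists of one point from each member of a maximal disjoint family of open sets
  controlled by \<open>H\<close> at the complement of \<open>x\<close>. For a neighbourhood
  \<open>U\<close> of \<open>x\<close>, maximality makes \<open>H x U\<close> meet a member; as
  \<open>x\<close> is not in its own complement, monotone normality puts the chosen point of that
  member into \<open>U\<close>.\<close>

lemma monotonically_normal_SD:
  assumes "monotonically_normal X"
  shows "SD_space X"
  unfolding SD_space_def
proof (intro ballI impI)
  fix x assume x: "x \<in> topspace X" "\<not> openin X {x}"
  obtain H where t1: "t1_space X"
    and H: "\<And>x U. openin X U \<Longrightarrow> x \<in> U \<Longrightarrow> openin X (H x U) \<and> x \<in> H x U \<and> H x U \<subseteq> U"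
    and sep: "\<And>x U y V. openin X U \<Longrightarrow> x \<in> U \<Longrightarrow> openin X V \<Longrightarrow> y \<in> V \<Longrightarrow>
      H x U \<inter> H y V \<noteq> {} \<Longrightarrow> x \<in> V \<or> y \<in> U"
    using assms unfolding monotonically_normal_def by metis
  let ?W = "topspace X - {x}"
  have W: "openin X ?W" using t1 openin_topspace t1_space_openin_delete_alt by metis
  \<comment> \<open>The point \<open>y\<close> has to lie in \<open>N\<close>, so that the points
    chosen from disjoint members are distinct.\<close>
  define F where "F = {N. openin X N \<and> (\<exists>y\<in>N. y \<in> ?W \<and> N \<subseteq> H y ?W)}"
  obtain \<M> where M': "\<M> \<subseteq> F" "pairwise disjnt \<M>"
      and max: "\<forall>A\<in>F. A \<noteq> {} \<longrightarrow> (\<exists>B\<in>\<M>. \<not> disjnt A B)"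
    using maximal_disjoint_subfamily[of F] by (elim exE conjE)
  note M = M'[unfolded F_def]
  have "\<forall>N\<in>\<M>. \<exists>y. y \<in> N \<and> y \<in> ?W \<and> N \<subseteq> H y ?W" using M(1) by blast
  then obtain p where p: "\<And>N. N \<in> \<M> \<Longrightarrow> p N \<in> N \<and> p N \<in> ?W \<and> N \<subseteq> H (p N) ?W" by metis
  have pinj: "M = N" if "M \<in> \<M>" "N \<in> \<M>" "p M \<in> N" for M N
  proof (rule ccontr)
    assume "M \<noteq> N"
    then have "disjnt M N" using M(2) that(1,2) by (simp add: pairwise_def)
    with p[OF that(1)] that(3) show False by (auto simp: disjnt_iff)
  qed
  have "inj_on p \<M>"
  proof (rule inj_onI)
    fix M N assume MN: "M \<in> \<M>" "N \<in> \<M>" "p M = p N"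
    then have "p M \<in> N" using p[OF MN(2)] by simp
    then show "M = N" by (rule pinj[OF MN(1,2)])
  qed
  then have inv: "inv_into \<M> p (p N) = N" if "N \<in> \<M>" for N
    using that by (rule inv_into_f_f)
  have "strongly_discrete X (p ` \<M>)"
    unfolding strongly_discrete_def
  proof (intro conjI exI[of _ "inv_into \<M> p"] ballI)
    show "p ` \<M> \<subseteq> topspace X" using p by blast
    show "disjoint_family_on (inv_into \<M> p) (p ` \<M>)"
      unfolding disjoint_family_on_def
    proof (intro ballI impI)
      fix a b assume ab: "a \<in> p ` \<M>" "b \<in> p ` \<M>" "a \<noteq> b"
      obtain A where A: "A \<in> \<M>" "a = p A" using ab(1) by (rule imageE)
      obtain B where B: "B \<in> \<M>" "b = p B" using ab(2) by (rule imageE)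
      have "disjnt A B" using A B ab(3) by (intro pairwiseD[OF M(2)]) auto
      then show "inv_into \<M> p a \<inter> inv_into \<M> p b = {}"
        using A B by (simp add: inv disjnt_def)
    qed
  qed (use M(1) p inv in auto)
  moreover have "x \<in> X derived_set_of (p ` \<M>)"
    unfolding in_derived_set_of
  proof (intro conjI allI impI x(1))
    fix U assume U: "x \<in> U \<and> openin X U"
    then have HU: "openin X (H x U)" "x \<in> H x U" using H by blast+
    with x(2) have "H x U \<noteq> {x}" by auto
    then obtain z where z: "z \<in> H x U" "z \<noteq> x" using HU(2) by blast
    have zW: "z \<in> ?W" using z openin_subset[OF HU(1)] by blast
    have Hz: "openin X (H z ?W)" "z \<in> H z ?W" using H[OF W zW] by auto
    have "H x U \<inter> H z ?W \<in> F" unfolding F_def using HU(1) Hz z(1) zW by blast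
    moreover have "H x U \<inter> H z ?W \<noteq> {}" using z(1) Hz(2) by blast
    ultimately have "\<exists>N\<in>\<M>. \<not> disjnt (H x U \<inter> H z ?W) N" using max by simp
    then obtain N where N: "N \<in> \<M>" "\<not> disjnt (H x U \<inter> H z ?W) N" by (rule bexE)
    have pN: "p N \<in> ?W" "N \<subseteq> H (p N) ?W" using p[OF N(1)] by simp_all
    have "H x U \<inter> H (p N) ?W \<noteq> {}" using N(2) pN(2) unfolding disjnt_def by blast
    then have "x \<in> ?W \<or> p N \<in> U" using sep[OF _ _ W pN(1), of U x] U by simp
    then have "p N \<in> U" by simp
    with N(1) pN(1) show "\<exists>y. y \<noteq> x \<and> y \<in> p ` \<M> \<and> y \<in> U" by blast
  qed
  ultimately show "\<exists>D. strongly_discrete X D \<and> x \<in> X derived_set_of D" by blast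
qed

lemma monotonically_normal_DSD: "monotonically_normal X \<Longrightarrow> DSD_space X"
  by (simp add: DSD_space_def monotonically_normal_SD monotonically_normal_subtopology)

theorem corollary3p18:
  fixes X :: "'a topology"
  assumes "topspace X \<noteq> {}"
    and "card_less_aleph_omega (topspace X)"
  shows "(DSD_space X \<longrightarrow> maximally_resolvable X) \<and>
         (monotonically_normal X \<longrightarrow> maximally_resolvable X)"
  using DSD_maximally_resolvable[OF assms] monotonically_normal_DSD by blast

end
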